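(* Let $P=(X,\prec)$ be a finite poset. Then for every integer $t\ge2$, $$\Omega(P,t)^2\ \ge\ \Omega(P,t+1)\cdot\Omega(P,t-1).$$
   Context: $\Omega(P,t)$ is the number of maps $g:X\to[t]$ with $g(x)\le g(y)$ whenever $x\prec y$. *)

theory Defs
  imports Main "HOL-Library.FuncSet"
begin

definition strict_poset_on :: "'a set \<Rightarrow> ('a \<Rightarrow> 'a \<Rightarrow> bool) \<Rightarrow> bool" where
  "strict_poset_on X prec \<longleftrightarrow> irreflp_on X prec \<and> transp_on X prec"

text \<open>
  The order polynomial at \<open>t\<close>. Extensional functions (equal to \<open>undefined\<close> outside \<open>X\<close>)
  represent each map from \<open>X\<close> to \<open>{1..t}\<close> exactly once. The maps are weakly order-preserving.
\<close>

definition order_poly :: "'a set \<Rightarrow> ('a \<Rightarrow> 'a \<Rightarrow> bool) \<Rightarrow> nat \<Rightarrow> nat" where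
  "order_poly X prec t = card {g \<in> X \<rightarrow>\<^sub>E {1..t}. monotone_on X prec (\<le>) g}"

end

theory Submission
  imports Defs Complex_Main
begin

text \<open>
  Shifting the values by one, \<open>\<Omega>(P,t-1)\<close> counts the monotone maps into \<open>{2..t}\<close>. The pointwise
  maximum of such a map with a monotone map into \<open>{1..t+1}\<close> takes values in \<open>{2..t+1}\<close>, and the
  pointwise minimum takes values in \<open>{1..t}\<close>; both intervals have \<open>t\<close> elements. Identifying a map
  with its hypograph turns maxima and minima into unions and intersections, so the claim is an
  instance of Daykin's inequality \<open>|\<A>| |\<B>| \<le> |\<A> \<or> \<B>| |\<A> \<and> \<B>|\<close>, which in turn follows
  from the four functions theorem of Ahlswede and Daykin.
\<close>

text \<open>This is the four functions theorem on a one-element ground set, the index recording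
  whether the element is present. Both cross products \<open>a0 * b1\<close> and
  \<open>a1 * b0\<close> are bounded by \<open>c1 * d0\<close>, while their product is at most
  \<open>(c1 * d0) * (c0 * d1)\<close>; together these bound their sum.\<close>

lemma four_functions_two_point:
  fixes a0 a1 b0 b1 c0 c1 d0 d1 :: real
  assumes nonneg: "0 \<le> a0" "0 \<le> a1" "0 \<le> b0" "0 \<le> b1" "0 \<le> c0" "0 \<le> c1" "0 \<le> d0" "0 \<le> d1"
    and le00: "a0 * b0 \<le> c0 * d0" and le01: "a0 * b1 \<le> c1 * d0"
    and le10: "a1 * b0 \<le> c1 * d0" and le11: "a1 * b1 \<le> c1 * d1"
  shows "(a0 + a1) * (b0 + b1) \<le> (c0 + c1) * (d0 + d1)"
\<comment> \<open>The main argument cancels the factor \<open>c1 * d0\<close>; if it is zero, both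
  cross products vanish.\<close>
proof (cases "c1 * d0 = 0")
  case True
  then have "a0 * b1 \<le> 0" "a1 * b0 \<le> 0"
    using le01 le10 unfolding True by simp_all
  moreover have "0 \<le> c0 * d1" "0 \<le> c1 * d0"
    using nonneg by simp_all
  ultimately show ?thesis
    using le00 le11 by (simp add: algebra_simps)
next
  case False
  define p where "p = c1 * d0"
  have p: "0 < p"
    using False nonneg unfolding p_def by (simp add: less_le)
  have "(a0 * b0) * (a1 * b1) \<le> (c0 * d0) * (c1 * d1)"
    by (rule mult_mono[OF le00 le11]) (use nonneg in simp_all)
  then have "(a0 * b1) * (a1 * b0) \<le> p * (c0 * d1)"
    by (simp add: p_def mult_ac)
  \<comment> \<open>With u and v the cross products, expanding (p - u)(p - v) gives p(u + v) \<le>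
    p^2 + uv, and uv was just bounded by a multiple of p.\<close>
  moreover have "0 \<le> (p - a0 * b1) * (p - a1 * b0)"
    using le01 le10 unfolding p_def by (intro mult_nonneg_nonneg) simp_all
  ultimately have "p * (a0 * b1 + a1 * b0) \<le> p * (p + c0 * d1)"
    by (simp add: algebra_simps)
  then have "a0 * b1 + a1 * b0 \<le> p + c0 * d1"
    using p by simp
  with le00 le11 show ?thesis
    by (simp add: algebra_simps p_def)
qed

lemma sum_Pow_insert:
  assumes "finite S" "x \<notin> S"
  shows "sum f (Pow (insert x S)) = (\<Sum>A\<in>Pow S. f A + f (insert x A))"
proof -
  have "inj_on (insert x) (Pow S)"
    using assms(2) by (intro inj_onI) (blast elim!: equalityE)
  moreover have "Pow S \<inter> insert x ` Pow S = {}"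
    using assms(2) by auto
  ultimately show ?thesis
    using assms(1) by (simp add: Pow_insert sum.union_disjoint sum.reindex sum.distrib)
qed

text \<open>Induction on the ground set: each function is folded onto \<open>Pow S\<close> by adding
  its values at \<open>A\<close> and \<open>insert x A\<close>. The two-point inequality shows that
  the folded functions again satisfy the hypothesis.\<close>

theorem four_functions:
  fixes \<alpha> \<beta> \<gamma> \<delta> :: "'a set \<Rightarrow> real"
  assumes "finite S"
    and "\<And>A. A \<subseteq> S \<Longrightarrow> 0 \<le> \<alpha> A" "\<And>A. A \<subseteq> S \<Longrightarrow> 0 \<le> \<beta> A"
    and "\<And>A. A \<subseteq> S \<Longrightarrow> 0 \<le> \<gamma> A" "\<And>A. A \<subseteq> S \<Longrightarrow> 0 \<le> \<delta> A"
    and "\<And>A B. A \<subseteq> S \<Longrightarrow> B \<subseteq> S \<Longrightarrow> \<alpha> A * \<beta> B \<le> \<gamma> (A \<union> B) * \<delta> (A \<inter> B)"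
  shows "sum \<alpha> (Pow S) * sum \<beta> (Pow S) \<le> sum \<gamma> (Pow S) * sum \<delta> (Pow S)"
  using assms
proof (induction S arbitrary: \<alpha> \<beta> \<gamma> \<delta> rule: finite_induct)
  case empty
  then show ?case
    using empty(5)[of "{}" "{}"] by simp
next
  case (insert x S)
  note nonneg = insert.prems(1-4) and le = insert.prems(5)
  have "(\<Sum>A\<in>Pow S. \<alpha> A + \<alpha> (insert x A)) * (\<Sum>A\<in>Pow S. \<beta> A + \<beta> (insert x A))
      \<le> (\<Sum>A\<in>Pow S. \<gamma> A + \<gamma> (insert x A)) * (\<Sum>A\<in>Pow S. \<delta> A + \<delta> (insert x A))"
  proof (rule insert.IH)
    fix A B assume AB: "A \<subseteq> S" "B \<subseteq> S"
    then have sub: "A \<subseteq> insert x S" "B \<subseteq> insert x S" "insert x A \<subseteq> insert x S"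
      "insert x B \<subseteq> insert x S" "A \<union> B \<subseteq> insert x S" "A \<inter> B \<subseteq> insert x S"
      "insert x (A \<union> B) \<subseteq> insert x S" "insert x (A \<inter> B) \<subseteq> insert x S"
      by auto
    \<comment> \<open>When only one of the two sets contains \<open>x\<close>, the union contains it
      and the intersection does not, so both mixed terms get the same bound, as the two-point
      inequality requires.\<close>
    have meet: "A \<inter> insert x B = A \<inter> B" "insert x A \<inter> B = A \<inter> B"
      using AB insert.hyps(2) by auto
    show "(\<alpha> A + \<alpha> (insert x A)) * (\<beta> B + \<beta> (insert x B))
      \<le> (\<gamma> (A \<union> B) + \<gamma> (insert x (A \<union> B))) * (\<delta> (A \<inter> B) + \<delta> (insert x (A \<inter> B)))"
      using le[OF sub(1) sub(2)] le[OF sub(1) sub(4)] le[OF sub(3) sub(2)] le[OF sub(3) sub(4)]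
      by (intro four_functions_two_point nonneg sub) (simp_all add: meet)
  qed (auto intro!: add_nonneg_nonneg nonneg)
  then show ?case
    by (simp only: sum_Pow_insert[OF insert.hyps(1,2)])
qed

text \<open>Apply the four functions theorem to the indicator functions of the families: its
  hypothesis has content only where both left factors are 1, and there \<open>union\<close> and
  \<open>inter\<close> make the right side 1.\<close>

corollary Daykin_inequality:
  assumes "finite S" and sub: "\<A> \<subseteq> Pow S" "\<B> \<subseteq> Pow S" "\<C> \<subseteq> Pow S" "\<D> \<subseteq> Pow S"
    and union: "\<And>A B. A \<in> \<A> \<Longrightarrow> B \<in> \<B> \<Longrightarrow> A \<union> B \<in> \<C>"
    and inter: "\<And>A B. A \<in> \<A> \<Longrightarrow> B \<in> \<B> \<Longrightarrow> A \<inter> B \<in> \<D>"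
  shows "card \<A> * card \<B> \<le> card \<C> * card \<D>"
proof -
  have card: "(\<Sum>A\<in>Pow S. of_bool (A \<in> \<F>)) = real (card \<F>)" if "\<F> \<subseteq> Pow S" for \<F>
    using that \<open>finite S\<close> by (simp add: Int_absorb1)
  have "(\<Sum>A\<in>Pow S. of_bool (A \<in> \<A>)) * (\<Sum>A\<in>Pow S. of_bool (A \<in> \<B>))
      \<le> (\<Sum>A\<in>Pow S. of_bool (A \<in> \<C>)) * (\<Sum>A\<in>Pow S. of_bool (A \<in> \<D>) :: real)"
    using \<open>finite S\<close> by (rule four_functions) (auto simp: union inter)
  then have "real (card \<A> * card \<B>) \<le> real (card \<C> * card \<D>)"
    by (simp add: card sub del: sum_of_bool_eq)
  then show ?thesis
    by (simp only: of_nat_le_iff)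
qed

definition monotone_maps :: "'a set \<Rightarrow> ('a \<Rightarrow> 'a \<Rightarrow> bool) \<Rightarrow> nat \<Rightarrow> nat \<Rightarrow> ('a \<Rightarrow> nat) set" where
  "monotone_maps X prec m n = {g \<in> X \<rightarrow>\<^sub>E {m..n}. monotone_on X prec (\<le>) g}"

lemma card_monotone_maps_Suc:
  "card (monotone_maps X prec (Suc m) (Suc n)) = card (monotone_maps X prec m n)"
proof -
  have "bij_betw (\<lambda>g. \<lambda>x\<in>X. Suc (g x)) (monotone_maps X prec m n)
          (monotone_maps X prec (Suc m) (Suc n))"
  proof (rule bij_betw_byWitness[where f' = "\<lambda>g. \<lambda>x\<in>X. g x - 1"])
    show "\<forall>g\<in>monotone_maps X prec m n. (\<lambda>x\<in>X. (\<lambda>x\<in>X. Suc (g x)) x - 1) = g"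
      by (auto simp: monotone_maps_def fun_eq_iff PiE_def extensional_def)
    \<comment> \<open>Values are at least \<open>Suc m\<close>, hence positive, so the truncated
      subtraction is undone by \<open>Suc\<close>.\<close>
    show "\<forall>g\<in>monotone_maps X prec (Suc m) (Suc n). (\<lambda>x\<in>X. Suc ((\<lambda>x\<in>X. g x - 1) x)) = g"
      by (fastforce simp: monotone_maps_def fun_eq_iff PiE_def extensional_def Pi_def)
    show "(\<lambda>g. \<lambda>x\<in>X. Suc (g x)) ` monotone_maps X prec m n
        \<subseteq> monotone_maps X prec (Suc m) (Suc n)"
      by (auto simp: monotone_maps_def monotone_on_def PiE_def Pi_def)
    show "(\<lambda>g. \<lambda>x\<in>X. g x - 1) ` monotone_maps X prec (Suc m) (Suc n)
        \<subseteq> monotone_maps X prec m n"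
      by (fastforce simp: monotone_maps_def monotone_on_def PiE_def Pi_def intro!: diff_le_mono)
  qed
  then show ?thesis
    by (simp add: bij_betw_same_card)
qed

definition hypograph :: "'a set \<Rightarrow> ('a \<Rightarrow> nat) \<Rightarrow> ('a \<times> nat) set" where
  "hypograph X g = (SIGMA x:X. {..<g x})"

lemma hypograph_inj: "inj_on (hypograph X) (extensional X)"
proof (rule inj_onI)
  fix g h assume ext: "g \<in> extensional X" "h \<in> extensional X"
    and eq: "hypograph X g = hypograph X h"
  have "{..<g x} = {..<h x}" if "x \<in> X" for x
    using eq that by (auto simp: hypograph_def set_eq_iff)
  with ext show "g = h"
    by (auto intro: extensionalityI)
qed

lemma hypograph_max:
  "hypograph X g \<union> hypograph X h = hypograph X (\<lambda>x\<in>X. max (g x) (h x))"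
  by (auto simp: hypograph_def)

lemma hypograph_min:
  "hypograph X g \<inter> hypograph X h = hypograph X (\<lambda>x\<in>X. min (g x) (h x))"
  by (auto simp: hypograph_def)

lemma max_monotone_maps:
  assumes "g \<in> monotone_maps X prec m n" "h \<in> monotone_maps X prec m' n'"
  shows "(\<lambda>x\<in>X. max (g x) (h x)) \<in> monotone_maps X prec (max m m') (max n n')"
  using assms by (fastforce simp: monotone_maps_def monotone_on_def PiE_def Pi_def intro: max.mono)

lemma min_monotone_maps:
  assumes "g \<in> monotone_maps X prec m n" "h \<in> monotone_maps X prec m' n'"
  shows "(\<lambda>x\<in>X. min (g x) (h x)) \<in> monotone_maps X prec (min m m') (min n n')"
  using assms by (fastforce simp: monotone_maps_def monotone_on_def PiE_def Pi_def intro: min.mono)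

lemma card_monotone_maps_lattice:
  assumes "finite X"
  shows "card (monotone_maps X prec m n) * card (monotone_maps X prec m' n')
    \<le> card (monotone_maps X prec (max m m') (max n n'))
      * card (monotone_maps X prec (min m m') (min n n'))"
proof -
  let ?H = "\<lambda>m n. hypograph X ` monotone_maps X prec m n"
  have card: "card (?H i j) = card (monotone_maps X prec i j)" for i j
    by (intro card_image inj_on_subset[OF hypograph_inj]) (auto simp: monotone_maps_def PiE_def)
  \<comment> \<open>One ground set serves all four families, since each of their upper bounds is at
    most \<open>max n n'\<close>.\<close>
  have sub: "?H i j \<subseteq> Pow (X \<times> {..<max n n'})" if "j \<le> max n n'" for i j
    using that by (fastforce simp: hypograph_def monotone_maps_def PiE_def Pi_def)
  have "card (?H m n) * card (?H m' n')
      \<le> card (?H (max m m') (max n n')) * card (?H (min m m') (min n n'))"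
  proof (rule Daykin_inequality)
    show "finite (X \<times> {..<max n n'})"
      using assms by simp
    show "A \<union> B \<in> ?H (max m m') (max n n')" if "A \<in> ?H m n" "B \<in> ?H m' n'" for A B
      using that by (auto simp: hypograph_max intro!: imageI max_monotone_maps)
    show "A \<inter> B \<in> ?H (min m m') (min n n')" if "A \<in> ?H m n" "B \<in> ?H m' n'" for A B
      using that by (auto simp: hypograph_min intro!: imageI min_monotone_maps)
  qed (intro sub; simp)+
  then show ?thesis
    by (simp only: card)
qed

theorem theorem4p7:
  fixes X :: "'a set" and prec :: "'a \<Rightarrow> 'a \<Rightarrow> bool" and t :: nat
  assumes "finite X"
    and "strict_poset_on X prec"
    and "2 \<le> t"
  shows "(order_poly X prec t)\<^sup>2 \<ge> order_poly X prec (t + 1) * order_poly X prec (t - 1)"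
proof -
  have poly: "order_poly X prec n = card (monotone_maps X prec 1 n)" for n
    by (simp add: order_poly_def monotone_maps_def)
  have shift: "order_poly X prec n = card (monotone_maps X prec 2 (n + 1))" for n
    using card_monotone_maps_Suc[of X prec 1 n] by (simp add: poly numeral_2_eq_2)
  have "order_poly X prec (t + 1) * order_poly X prec (t - 1)
      = card (monotone_maps X prec 1 (t + 1)) * card (monotone_maps X prec 2 t)"
    \<comment> \<open>Only the factor at \<open>t - 1\<close> is shifted; the bound on
      \<open>t\<close> ensures \<open>t - 1 + 1 = t\<close>.\<close>
    using \<open>2 \<le> t\<close> unfolding poly[of "t + 1"] shift[of "t - 1"] by simp
  also have "\<dots> \<le> card (monotone_maps X prec 2 (t + 1)) * card (monotone_maps X prec 1 t)"
    using card_monotone_maps_lattice[OF \<open>finite X\<close>, of prec 1 "t + 1" 2 t] by (simp add: max_def min_def)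
  also have "\<dots> = (order_poly X prec t)\<^sup>2"
    \<comment> \<open>The ranges \<open>{2..t + 1}\<close> and \<open>{1..t}\<close> both give the
      count at \<open>t\<close>, one with the shift and one without.\<close>
    by (simp only: poly[of t, symmetric] shift[of t, symmetric] power2_eq_square)
  finally show ?thesis .
qed

end
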